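(* The recurrences of single-layer SRU, T-RNN, and SCRN architectures are rational (over the real semiring).
   Context: Models. SRU = simple recurrent unit, T-RNN = strongly-typed RNN, SCRN = structurally constrained RNN. Only the recurrent computation, i.e. how the hidden state $\mathbf{c}_t$ is computed, is considered. Let $\Sigma$ be a finite alphabet; for an input sequence $\mathbf{x}=x_1\dots x_n$ over $\Sigma$, let $\mathbf{v}_t$ be the word embedding vector of $x_t$. These models are treated as simplified versions of the following RNN with hidden size $d$: a forget gate $\mathbf{f}_t=\bm{\sigma}(\mathbf{W}_f\mathbf{v}_t+\mathbf{b}_f)$, an input representation $\mathbf{u}_t=(\mathbf{1}-\mathbf{f}_t)\odot\bm{g}(\mathbf{W}_u\mathbf{v}_t+\mathbf{b}_u)$ with optional nonlinearity $\bm g$, and the hidden state update $$\mathbf{c}_t=\mathbf{f}_t\odot\mathbf{c}_{t-1}+\mathbf{u}_t,\qquad \mathbf{c}_0=\mathbf{0}.$$ In SRU, T-RNN and SCRN the hidden state is updated by this same rule, but the input representation is computed without the bias term or any nonlinearity: $\mathbf{u}_t=\mathbf{W}_u\mathbf{v}_t$. In particular $\mathbf{f}_t$ and $\mathbf{u}_t$ depend only on the current input token $x_t$ and not on the previous state. Here $\odot$ is the elementwise product, $\mathbf{1}$ the all-ones vector, $\bm\sigma$ the elementwise sigmoid, and the $\mathbf{W}$'s and $\mathbf{b}$'s are real parameter matrices and vectors. The function whose recurrence is considered is $\mathbf{c}:\Sigma^\ast\to\mathbb{R}^d$, $\mathbf{c}(x_1\dots x_t)=\mathbf{c}_t$. A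 weighted finite-state automaton (WFSA) over a semiring $\langle\mathbb{K},\oplus,\otimes,\bar0,\bar1\rangle$ is a tuple $\mathscr{A}=\langle\Sigma,\mathcal{Q},\tau,\lambda,\rho\rangle$ with finite alphabet $\Sigma$, finite state set $\mathcal{Q}$, transition weights $\tau:\mathcal{Q}\times\mathcal{Q}\times(\Sigma\cup\{\varepsilon\})\to\mathbb{K}$ (with $\varepsilon\notin\Sigma$ marking transitions that consume no input), initial weights $\lambda:\mathcal{Q}\to\mathbb{K}$ and final weights $\rho:\mathcal{Q}\to\mathbb{K}$. A path $\bm\pi=\pi_1\dots\pi_n$ is a sequence of adjacent transitions $\pi_k=(q_k,q_{k+1},z_k)$; it derives the string obtained from $z_1\dots z_n$ by deleting all $\varepsilon$'s. Its score is $\mathscr{A}[\bm\pi]=\lambda(q_1)\otimes\bigl(\bigotimes_{k=1}^n\tau(\pi_k)\bigr)\otimes\rho(q_{n+1})$. The score of a string $\mathbf{x}$ is $\mathscr{A}\llbracket\mathbf{x}\rrbracket=\bigoplus_{\bm\pi}\mathscr{A}[\bm\pi]$, summed over all paths deriving $\mathbf{x}$. Rational recurrence: for a function $\mathbf{c}:\Sigma^\ast\to\mathbb{K}^d$, its recurrence is the dependence of $\mathbf{c}(x_1\dots x_t)$ on $\mathbf{c}(x_1\dots x_{t-1})$. The recurrence is rational if there is a set of WFSAs $\{\mathscr{A}_i\}_{i=1}^d$ over alphabet $\Sigma$ and semiring $\langle\mathbb{K},\oplus,\otimes,\bar0,\bar1\rangle$, with both $\oplus$ and $\otimes$ taking constant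 time and space, such that $[\mathbf{c}(\mathbf{x})]_i=\mathscr{A}_i\llbracket\mathbf{x}\rrbracket$ for all $\mathbf{x}\in\Sigma^\ast$ and all $i\in\{1,\dots,d\}$. Here the semiring is the real semiring $\langle\mathbb{R},+,\cdot,0,1\rangle$. *)

theory Defs
  imports "HOL-Analysis.Analysis"
begin

text \<open>The input label \<^term>\<open>None\<close> stands for the empty symbol epsilon. Values of the weight
  functions outside the alphabet and the state set are irrelevant, since paths never use them.\<close>

record ('a, 'q, 'k) wfsa =
  alphabet :: "'a set"
  states :: "'q set"
  trans_weight :: "'q \<times> 'q \<times> 'a option \<Rightarrow> 'k"
  init_weight :: "'q \<Rightarrow> 'k"
  final_weight :: "'q \<Rightarrow> 'k"

definition is_wfsa :: "('a, 'q, 'k) wfsa \<Rightarrow> bool" where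
  "is_wfsa A \<longleftrightarrow> finite (alphabet A) \<and> finite (states A)"

text \<open>A path is given by its first state together with its list of transitions; carrying the
  first state explicitly makes sense of paths with no transitions, which derive the empty string.\<close>

fun is_path :: "('a, 'q, 'k) wfsa \<Rightarrow> 'q \<Rightarrow> ('q \<times> 'q \<times> 'a option) list \<Rightarrow> bool" where
  "is_path A q [] \<longleftrightarrow> q \<in> states A"
| "is_path A q ((p, r, z) # ts) \<longleftrightarrow>
     p = q \<and> q \<in> states A \<and> z \<in> insert None (Some ` alphabet A) \<and> is_path A r ts"

fun path_end :: "'q \<Rightarrow> ('q \<times> 'q \<times> 'a option) list \<Rightarrow> 'q" where
  "path_end q [] = q"
| "path_end q ((p, r, z) # ts) = path_end r ts"

definition derived_string :: "('q \<times> 'q \<times> 'a option) list \<Rightarrow> 'a list" where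
  "derived_string ts = List.map_filter (\<lambda>(p, r, z). z) ts"

definition paths_deriving ::
    "('a, 'q, 'k) wfsa \<Rightarrow> 'a list \<Rightarrow> ('q \<times> ('q \<times> 'q \<times> 'a option) list) set" where
  "paths_deriving A x = {(q, ts). is_path A q ts \<and> derived_string ts = x}"

definition path_score ::
    "('a, 'q, 'k::semiring_1) wfsa \<Rightarrow> 'q \<times> ('q \<times> 'q \<times> 'a option) list \<Rightarrow> 'k" where
  "path_score A = (\<lambda>(q, ts).
     init_weight A q * prod_list (map (trans_weight A) ts) * final_weight A (path_end q ts))"

text \<open>Because of epsilon-transitions a string may have infinitely many paths (possibly all but finitely
  many of weight 0), so its score is an unordered infinite sum. The relation below says that this
  sum exists and equals \<open>s\<close>; a divergent sum is not given a default value. The topology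
  on the semiring serves only to give meaning to such sums.\<close>

definition has_string_score ::
    "('a, 'q, 'k::{semiring_1, t2_space}) wfsa \<Rightarrow> 'a list \<Rightarrow> 'k \<Rightarrow> bool" where
  "has_string_score A x s \<longleftrightarrow> (path_score A has_sum s) (paths_deriving A x)"

text \<open>Every finite state set can be renamed to a finite set of natural numbers, so taking states
  in \<^typ>\<open>nat\<close> loses no generality. The semiring is the one of the type class instance at \<open>'k\<close>.\<close>

definition rational_recurrence ::
    "'a set \<Rightarrow> ('a list \<Rightarrow> 'k::{semiring_1, t2_space} ^ 'd::finite) \<Rightarrow> bool" where
  "rational_recurrence \<Sigma> c \<longleftrightarrow>
     (\<exists>A :: 'd \<Rightarrow> ('a, nat, 'k) wfsa. \<forall>i.
        is_wfsa (A i) \<and> alphabet (A i) = \<Sigma> \<and>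
        (\<forall>x \<in> lists \<Sigma>. has_string_score (A i) x (c x $ i)))"

definition sigmoid :: "real \<Rightarrow> real" where
  "sigmoid x = 1 / (1 + exp (- x))"

definition forget_gate ::
    "real ^ 'm ^ 'd \<Rightarrow> real ^ 'd \<Rightarrow> ('a \<Rightarrow> real ^ 'm) \<Rightarrow> 'a \<Rightarrow> real ^ 'd" where
  "forget_gate W\<^sub>f b\<^sub>f v a = (\<chi> i. sigmoid ((W\<^sub>f *v v a + b\<^sub>f) $ i))"

text \<open>Multiplication on \<^typ>\<open>real ^ 'd\<close> is the elementwise product.\<close>

definition hidden_state ::
    "('a \<Rightarrow> real ^ 'd) \<Rightarrow> ('a \<Rightarrow> real ^ 'd) \<Rightarrow> 'a list \<Rightarrow> real ^ 'd" where
  "hidden_state f u x = foldl (\<lambda>c a. f a * c + u a) 0 x"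

text \<open>SRU, T-RNN and SCRN share this hidden-state computation; the input representation has
  neither a bias nor a nonlinearity. The function \<open>v\<close> is the word embedding.\<close>

definition sru_trnn_scrn_state ::
    "real ^ 'm ^ 'd \<Rightarrow> real ^ 'd \<Rightarrow> real ^ 'm ^ 'd \<Rightarrow> ('a \<Rightarrow> real ^ 'm) \<Rightarrow> 'a list \<Rightarrow> real ^ 'd" where
  "sru_trnn_scrn_state W\<^sub>f b\<^sub>f W\<^sub>u v = hidden_state (forget_gate W\<^sub>f b\<^sub>f v) (\<lambda>a. W\<^sub>u *v v a)"

end

(* The coordinate i is computed by a two-state automaton: state 0 loops with weight 1, state 1 loops
   with weight f a $ i, a transition from 0 to 1 has weight u a $ i, and a path starts in 0 and is
   counted when it ends in 1. A path is thus a choice of the time s of the jump, and its score is the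
   contribution u_s * f_(s+1) * ... * f_t of the input s to the unrolled recurrence. *)

theory Submission imports Defs begin

text \<open>The epsilon-free part of \<open>paths_deriving\<close> from a fixed start state. Epsilon
  labels can be inserted without bound, so \<open>paths_deriving\<close> may be infinite, while this
  set is finite for a finite automaton.\<close>

definition reading_paths ::
    "('a, 'q, 'k) wfsa \<Rightarrow> 'q \<Rightarrow> 'a list \<Rightarrow> ('q \<times> 'q \<times> 'a option) list set" where
  "reading_paths A q x = {ts. is_path A q ts \<and> map (snd \<circ> snd) ts = map Some x}"

text \<open>The backward algorithm, restricted to transitions that consume a symbol.\<close>

fun suffix_score :: "('a, 'q, 'k::semiring_1) wfsa \<Rightarrow> 'a list \<Rightarrow> 'q \<Rightarrow> 'k" where
  "suffix_score A [] q = final_weight A q"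
| "suffix_score A (a # x) q =
     (\<Sum>r\<in>states A. trans_weight A (q, r, Some a) * suffix_score A x r)"

lemma is_path_start: "is_path A q ts \<Longrightarrow> q \<in> states A"
  by (cases ts) auto

lemma derived_string_simps [simp]:
  "derived_string [] = []"
  "derived_string ((p, r, None) # ts) = derived_string ts"
  "derived_string ((p, r, Some a) # ts) = a # derived_string ts"
  by (simp_all add: derived_string_def map_filter_simps)

lemma derived_string_eq_if_labels:
  "map (snd \<circ> snd) ts = map Some x \<Longrightarrow> derived_string ts = x"
  by (induction ts arbitrary: x) auto

lemma labels_eq_derived_string:
  "None \<notin> (snd \<circ> snd) ` set ts \<Longrightarrow> map (snd \<circ> snd) ts = map Some (derived_string ts)"
  proof (induction ts)
  case (Cons t ts)
  then show ?case by (cases t; cases "snd (snd t)") auto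
qed simp

lemma reading_paths_Nil: "q \<in> states A \<Longrightarrow> reading_paths A q [] = {[]}"
  by (auto simp: reading_paths_def)

lemma reading_paths_Cons:
  assumes "q \<in> states A" "a \<in> alphabet A"
  shows "reading_paths A q (a # x) = (\<Union>r\<in>states A. (#) (q, r, Some a) ` reading_paths A r x)"
proof (rule set_eqI)
  fix ts
  show "ts \<in> reading_paths A q (a # x) \<longleftrightarrow>
    ts \<in> (\<Union>r\<in>states A. (#) (q, r, Some a) ` reading_paths A r x)"
    using assms is_path_start[of A]
    by (cases ts) (auto simp: reading_paths_def image_iff)
qed

lemma finite_reading_paths:
  assumes "is_wfsa A" "x \<in> lists (alphabet A)" "q \<in> states A"
  shows "finite (reading_paths A q x)"
  using assms(2,3)
proof (induction x arbitrary: q rule: lists.induct)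
  case Nil
  then show ?case by (simp add: reading_paths_Nil)
next
  case (Cons a x)
  then show ?case using assms(1) by (simp add: reading_paths_Cons is_wfsa_def)
qed

text \<open>Paths are grouped by the target of their first transition. The groups are disjoint, and
  within each one the weight of that transition is a common left factor, so distributivity yields
  the backward recursion.\<close>

lemma sum_reading_paths:
  assumes "is_wfsa A" "x \<in> lists (alphabet A)" "q \<in> states A"
  shows "(\<Sum>ts\<in>reading_paths A q x.
            prod_list (map (trans_weight A) ts) * final_weight A (path_end q ts))
         = suffix_score A x q"
  using assms(2,3)
proof (induction x arbitrary: q rule: lists.induct)
  case Nil
  then show ?case by (simp add: reading_paths_Nil)
next
  case (Cons a x)
  let ?w = "\<lambda>q ts. prod_list (map (trans_weight A) ts) * final_weight A (path_end q ts)"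
  have "sum (?w q) (reading_paths A q (a # x)) =
        (\<Sum>r\<in>states A. sum (?w q) ((#) (q, r, Some a) ` reading_paths A r x))"
    unfolding reading_paths_Cons[OF Cons.prems Cons.hyps(1)]
    by (rule sum.UNION_disjoint)
      (use assms(1) Cons.hyps in
        \<open>auto simp: is_wfsa_def intro: finite_reading_paths[OF assms(1)]\<close>)
  also have "\<dots> = (\<Sum>r\<in>states A. trans_weight A (q, r, Some a) * suffix_score A x r)"
    by (rule sum.cong)
      (simp_all add: sum.reindex Cons.IH[symmetric] sum_distrib_left mult.assoc)
  finally show ?case by simp
qed

text \<open>A single epsilon transition annihilates the score of its path, so the possibly infinite
  sum has its support in a finite set and therefore exists.\<close>

lemma has_string_score_if_no_epsilon:
  fixes A :: "('a, 'q, 'k::{semiring_1, t2_space}) wfsa"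
  assumes "is_wfsa A" "x \<in> lists (alphabet A)"
    and eps: "\<And>p r. trans_weight A (p, r, None) = 0"
  shows "has_string_score A x (\<Sum>q\<in>states A. init_weight A q * suffix_score A x q)"
proof -
  let ?P = "Sigma (states A) (\<lambda>q. reading_paths A q x)"
  have fin: "finite ?P"
    using assms by (auto simp: is_wfsa_def intro!: finite_SigmaI finite_reading_paths[OF assms(1)])
  have sub: "?P \<subseteq> paths_deriving A x"
    by (auto simp: paths_deriving_def reading_paths_def derived_string_eq_if_labels)
  have zero: "path_score A \<pi> = 0" if "\<pi> \<in> paths_deriving A x - ?P" for \<pi>
  proof -
    obtain q ts where \<pi>: "\<pi> = (q, ts)" by fastforce
    \<comment> \<open>Without an epsilon the labels would spell exactly \<open>x\<close>, which
      would put the path in \<open>?P\<close>.\<close>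
    with that have "None \<in> (snd \<circ> snd) ` set ts"
      using labels_eq_derived_string[of ts]
      by (auto simp: paths_deriving_def reading_paths_def dest: is_path_start)
    then obtain p r where "(p, r, None) \<in> set ts" by force
    then obtain us vs where "ts = us @ (p, r, None) # vs" by (meson split_list)
    then show ?thesis by (simp add: \<pi> path_score_def eps)
  qed
  have "sum (path_score A) ?P = (\<Sum>q\<in>states A. \<Sum>ts\<in>reading_paths A q x. path_score A (q, ts))"
    using assms
    by (subst sum.Sigma) (auto simp: is_wfsa_def intro!: finite_reading_paths[OF assms(1)])
  also have "\<dots> = (\<Sum>q\<in>states A. init_weight A q * suffix_score A x q)"
    using assms(1,2)
    by (intro sum.cong refl)
      (simp add: path_score_def sum_reading_paths[symmetric] sum_distrib_left mult.assoc)
  finally have "(path_score A has_sum (\<Sum>q\<in>states A. init_weight A q * suffix_score A x q)) ?P"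
    using has_sum_finite[OF fin, of "path_score A"] by simp
  also have "?this \<longleftrightarrow>
      (path_score A has_sum (\<Sum>q\<in>states A. init_weight A q * suffix_score A x q)) (paths_deriving A x)"
    by (rule has_sum_cong_neutral) (use sub zero in auto)
  finally show ?thesis by (simp add: has_string_score_def)
qed

definition gated_wfsa ::
    "'a set \<Rightarrow> ('a \<Rightarrow> 'k) \<Rightarrow> ('a \<Rightarrow> 'k) \<Rightarrow> ('a, nat, 'k::semiring_1) wfsa" where
  "gated_wfsa \<Sigma> f u = \<lparr>
     alphabet = \<Sigma>,
     states = {0, 1},
     trans_weight = (\<lambda>(p, r, z). case z of None \<Rightarrow> 0 | Some a \<Rightarrow>
       if p = 0 \<and> r = 0 then 1 else if p = 0 \<and> r = 1 then u a
       else if p = 1 \<and> r = 1 then f a else 0),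
     init_weight = (\<lambda>q. if q = 0 then 1 else 0),
     final_weight = (\<lambda>q. if q = 1 then 1 else 0)\<rparr>"

text \<open>Each update is affine in the old state, hence so is the whole fold: state 1 supplies the
  slope, the product of all gates, and state 0 the constant term. The start value is left general
  because the induction changes it at every symbol.\<close>

lemma foldl_eq_suffix_score:
  fixes f u :: "'a \<Rightarrow> 'k::comm_semiring_1"
  shows "foldl (\<lambda>c a. f a * c + u a) c x =
    c * suffix_score (gated_wfsa \<Sigma> f u) x 1 + suffix_score (gated_wfsa \<Sigma> f u) x 0"
  by (induction x arbitrary: c) (simp_all add: gated_wfsa_def algebra_simps)

text \<open>The update is elementwise, so coordinates never interact and each can have its own
  automaton.\<close>

lemma hidden_state_nth:
  "hidden_state f u x $ i = foldl (\<lambda>c a. f a $ i * c + u a $ i) 0 x"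
proof -
  have "foldl (\<lambda>c a. f a * c + u a) c x $ i = foldl (\<lambda>c a. f a $ i * c + u a $ i) (c $ i) x" for c
    by (induction x arbitrary: c) simp_all
  then show ?thesis by (simp add: hidden_state_def)
qed

text \<open>Gate and input are functions of the current symbol alone, which is what allows them to
  serve as transition weights.\<close>

lemma rational_recurrence_hidden_state:
  assumes "finite \<Sigma>"
  shows "rational_recurrence \<Sigma> (hidden_state f u)"
proof -
  let ?A = "\<lambda>i. gated_wfsa \<Sigma> (\<lambda>a. f a $ i) (\<lambda>a. u a $ i)"
  have wf: "is_wfsa (?A i)" "alphabet (?A i) = \<Sigma>" for i
    using assms by (simp_all add: is_wfsa_def gated_wfsa_def)
  have "has_string_score (?A i) x (hidden_state f u x $ i)" if "x \<in> lists \<Sigma>" for x i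
  proof -
    have "hidden_state f u x $ i =
        (\<Sum>q\<in>states (?A i). init_weight (?A i) q * suffix_score (?A i) x q)"
      \<comment> \<open>The start value 0 removes the contribution of state 1 on the left; the
        initial weights remove it on the right.\<close>
      by (simp add: hidden_state_nth foldl_eq_suffix_score[where \<Sigma> = \<Sigma>])
        (simp add: gated_wfsa_def)
    moreover have "trans_weight (?A i) (p, r, None) = 0" for p r
      by (simp add: gated_wfsa_def)
    ultimately show ?thesis
      using has_string_score_if_no_epsilon[of "?A i" x] wf that by simp
  qed
  then show ?thesis
    unfolding rational_recurrence_def using wf by (intro exI[of _ ?A]) blast
qed

theorem corollary10:
  fixes \<Sigma> :: "'a set"
    and v :: "'a \<Rightarrow> real ^ 'm"
    and W\<^sub>f W\<^sub>u :: "real ^ 'm ^ 'd"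
    and b\<^sub>f :: "real ^ 'd"
  assumes "finite \<Sigma>"
  shows "rational_recurrence \<Sigma> (sru_trnn_scrn_state W\<^sub>f b\<^sub>f W\<^sub>u v)"
  unfolding sru_trnn_scrn_state_def using assms by (rule rational_recurrence_hidden_state)

end
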